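(* Let $\mathbf A$ be a conic idempotent residuated lattice. Then $\mathbf A$ is conjunctive if and only if all of its blocks are lattices; equivalently, if and only if all of its positive blocks are lattices.
   Context: A residuated lattice is an algebra $(A,\wedge,\vee,\cdot,\backslash,/,1)$ such that $(A,\wedge,\vee)$ is a lattice, $(A,\cdot,1)$ is a monoid, and $y\le x\backslash z \iff x\cdot y\le z\iff x\le z/y$ for all $x,y,z$. It is idempotent if it satisfies $x\cdot x=x$, and conic if every $a\in A$ satisfies $a\le 1$ or $1\le a$. Define $x^r:=x\backslash 1$, $x^\ell:=1/x$, $\gamma(x):=x^{\ell r}\wedge x^{r\ell}$ (superscripts are applied from left to right). $\mathbf A$ is conjunctive if it satisfies $\gamma(x\wedge y)=\gamma(x)\wedge\gamma(y)$. Let $A^i:=\{x^\ell:x\in A\}\cup\{x^r:x\in A\}$. The blocks of $\mathbf A$ are the sets $\gamma^{-1}(a)$ for $a\in A^i$, with the order inherited from $\mathbf A$; the block $\gamma^{-1}(a)$ is positive if $a\ge 1$. (Each block is a join-subsemilattice of $\mathbf A$ that becomes a lattice after adjoining a new bottom element.) *)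

theory Defs
  imports Main "HOL-Algebra.Lattice"
begin

text \<open>\<open>lres x z\<close> is the left residual \<open>x\z\<close> and \<open>rres z y\<close> is the right residual \<open>z/y\<close>.\<close>

class residuated_lattice = lattice + monoid_mult +
  fixes lres :: "'a \<Rightarrow> 'a \<Rightarrow> 'a"
    and rres :: "'a \<Rightarrow> 'a \<Rightarrow> 'a"
  assumes le_lres_iff: "y \<le> lres x z \<longleftrightarrow> x * y \<le> z"
    and le_rres_iff: "x \<le> rres z y \<longleftrightarrow> x * y \<le> z"

definition idempotent_rl :: "'a::residuated_lattice itself \<Rightarrow> bool"
  where "idempotent_rl _ \<longleftrightarrow> (\<forall>x::'a. x * x = x)"

definition conic_rl :: "'a::residuated_lattice itself \<Rightarrow> bool"
  where "conic_rl _ \<longleftrightarrow> (\<forall>a::'a. a \<le> 1 \<or> 1 \<le> a)"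

text \<open>The inverses \<open>x\<^sup>r = lres x 1\<close> and \<open>x\<^sup>l = rres 1 x\<close>.\<close>

definition rinv :: "'a::residuated_lattice \<Rightarrow> 'a"
  where "rinv x = lres x 1"

definition linv :: "'a::residuated_lattice \<Rightarrow> 'a"
  where "linv x = rres 1 x"

text \<open>Iterated superscripts are applied from left to right: \<open>x\<^sup>l\<^sup>r\<close> is \<open>(x\<^sup>l)\<^sup>r\<close>.\<close>

definition gam :: "'a::residuated_lattice \<Rightarrow> 'a"
  where "gam x = inf (rinv (linv x)) (linv (rinv x))"

definition conjunctive_rl :: "'a::residuated_lattice itself \<Rightarrow> bool"
  where "conjunctive_rl _ \<longleftrightarrow> (\<forall>x y::'a. gam (inf x y) = inf (gam x) (gam y))"

definition inverse_elements :: "'a::residuated_lattice set"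
  where "inverse_elements = range linv \<union> range rinv"

definition blocks :: "'a::residuated_lattice set set"
  where "blocks = {gam -` {a} | a. a \<in> inverse_elements}"

definition positive_blocks :: "'a::residuated_lattice set set"
  where "positive_blocks = {gam -` {a} | a. a \<in> inverse_elements \<and> 1 \<le> a}"

text \<open>The subset \<open>B\<close> with the inherited order is a lattice in its own right: joins and meets
  are taken within \<open>B\<close> and need not agree with \<open>sup\<close> and \<open>inf\<close> of the ambient type.\<close>

definition is_lattice_on :: "'a::order set \<Rightarrow> bool"
  where "is_lattice_on B \<longleftrightarrow> Lattice.lattice \<lparr>carrier = B, eq = (=), le = (\<le>)\<rparr>"

end

theory Submission
  imports Defs
begin

text \<open>In a conic idempotent residuated lattice the product of a negative and a positive element is
  one of the two factors, and this forces every inverse element to be comparable with \<^emph>\<open>every\<close>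
  element. Hence \<open>gam\<close> is a closure operator whose image is a chain of such elements, and
  \<open>gam (inf x y) = inf (gam x) (gam y)\<close> is automatic unless \<open>x\<close> and \<open>y\<close> lie in the same block.
  Within a block the equation says exactly that \<open>x\<close> and \<open>y\<close> have a common lower bound in the block.
  For a block below \<open>1\<close> this always holds: otherwise \<open>inf x y = x * y\<close> would be an inverse \<open>b\<close> of
  some \<open>c\<close>, and both \<open>x\<close> and \<open>y\<close> would be absorbed by \<open>c\<close>, hence so would \<open>b\<close>, which forces
  \<open>b = 1\<close>.\<close>

section \<open>Residuated lattices\<close>

lemma mult_left_mono_rl:
  fixes x y z :: "'a::residuated_lattice"
  assumes "y \<le> z"
  shows "x * y \<le> x * z"
  using assms by (meson le_lres_iff order_refl order_trans)

lemma mult_right_mono_rl: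
  fixes x y z :: "'a::residuated_lattice"
  assumes "x \<le> y"
  shows "x * z \<le> y * z"
  using assms by (meson le_rres_iff order_refl order_trans)

lemma le_rinv_iff: "y \<le> rinv x \<longleftrightarrow> x * y \<le> (1::'a::residuated_lattice)"
  by (simp add: rinv_def le_lres_iff)

lemma le_linv_iff: "y \<le> linv x \<longleftrightarrow> y * x \<le> (1::'a::residuated_lattice)"
  by (simp add: linv_def le_rres_iff)

text \<open>\<open>linv\<close> and \<open>rinv\<close> form an antitone Galois connection; the next
  four lemmas are its formal consequences.\<close>

lemma le_linv_iff_le_rinv: "y \<le> linv x \<longleftrightarrow> x \<le> rinv (y::'a::residuated_lattice)"
  by (simp add: le_rinv_iff le_linv_iff)

lemma mult_rinv_le: "x * rinv x \<le> (1::'a::residuated_lattice)"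
  by (simp flip: le_rinv_iff)

lemma linv_mult_le: "linv x * x \<le> (1::'a::residuated_lattice)"
  by (simp flip: le_linv_iff)

lemma linv_antimono: "x \<le> y \<Longrightarrow> linv y \<le> linv (x::'a::residuated_lattice)"
  by (meson le_linv_iff_le_rinv order_refl order_trans)

lemma rinv_antimono: "x \<le> y \<Longrightarrow> rinv y \<le> rinv (x::'a::residuated_lattice)"
  by (meson le_linv_iff_le_rinv order_refl order_trans)

lemma le_rinv_linv: "x \<le> rinv (linv (x::'a::residuated_lattice))"
  by (simp flip: le_linv_iff_le_rinv)

lemma le_linv_rinv: "x \<le> linv (rinv (x::'a::residuated_lattice))"
  by (simp add: le_linv_iff_le_rinv)

lemma le_gam: "x \<le> gam (x::'a::residuated_lattice)"
  by (simp add: gam_def le_rinv_linv le_linv_rinv)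

lemma gam_mono: "x \<le> y \<Longrightarrow> gam x \<le> gam (y::'a::residuated_lattice)"
  unfolding gam_def by (intro inf_mono linv_antimono rinv_antimono)

text \<open>Triple-inverse law of the Galois connection: one of the two double inverses in
  \<open>gam a\<close> is already below \<open>a\<close>.\<close>

lemma gam_inverse_element:
  fixes a :: "'a::residuated_lattice"
  assumes "a \<in> inverse_elements"
  shows "gam a = a"
proof (rule antisym)
  consider x where "a = linv x" | x where "a = rinv x"
    using assms by (auto simp: inverse_elements_def)
  then show "gam a \<le> a"
  proof cases
    case 1
    then show ?thesis
      by (simp add: gam_def le_infI2 linv_antimono le_rinv_linv)
  next
    case 2
    then show ?thesis
      by (simp add: gam_def le_infI1 rinv_antimono le_linv_rinv)
  qed
qed (rule le_gam)

section \<open>Conic idempotent residuated lattices\<close>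

context
  assumes conic: "conic_rl TYPE('a::residuated_lattice)"
    and idempotent: "idempotent_rl TYPE('a)"
begin

section \<open>Products according to the signs of the factors\<close>

lemma le_one_or_ge_one: "(x::'a) \<le> 1 \<or> 1 \<le> x"
  using conic by (simp add: conic_rl_def)

lemma mult_self: "(x::'a) * x = x"
  using idempotent by (simp add: idempotent_rl_def)

lemma mult_self_left: "(x::'a) * (x * y) = x * y"
  by (simp add: mult_self flip: mult.assoc)

lemma mult_self_right: "((x::'a) * y) * y = x * y"
  by (simp add: mult_self mult.assoc)

text \<open>Monotonicity gives one inequality; for the other, \<open>inf x y\<close> is its own
  square.\<close>

lemma mult_eq_inf:
  fixes x y :: 'a
  assumes "x \<le> 1" "y \<le> 1"
  shows "x * y = inf x y"
proof (rule antisym)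
  show "x * y \<le> inf x y"
    using mult_left_mono_rl[of y 1 x] mult_right_mono_rl[of x 1 y] assms by simp
  show "inf x y \<le> x * y"
    using mult_left_mono_rl[of "inf x y" y "inf x y"] mult_right_mono_rl[of "inf x y" x y]
    by (simp add: mult_self)
qed

lemma mult_eq_sup:
  fixes x y :: 'a
  assumes "1 \<le> x" "1 \<le> y"
  shows "x * y = sup x y"
proof (rule antisym)
  show "sup x y \<le> x * y"
    using mult_left_mono_rl[of 1 y x] mult_right_mono_rl[of 1 x y] assms by simp
  show "x * y \<le> sup x y"
    using mult_left_mono_rl[of y "sup x y" "sup x y"] mult_right_mono_rl[of x "sup x y" y]
    by (simp add: mult_self)
qed

text \<open>Monotonicity puts \<open>x * y\<close> between \<open>x\<close> and \<open>y\<close>.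
  Rewriting it as \<open>x * (x * y)\<close> or as \<open>(x * y) * y\<close> gives a product of two
  elements of equal sign, that is, a meet or a join.\<close>

lemma neg_mult_pos:
  fixes x y :: 'a
  assumes "x \<le> 1" "1 \<le> y"
  shows "x * y = (if x * y \<le> 1 then x else y)"
proof -
  have "x \<le> x * y" "x * y \<le> y"
    using mult_left_mono_rl[of 1 y x] mult_right_mono_rl[of x 1 y] assms by simp_all
  moreover have "x * y \<le> x" if "x * y \<le> 1"
    using mult_eq_inf[OF assms(1) that] by (metis mult_self_left inf_le1)
  moreover have "y \<le> x * y" if "1 \<le> x * y"
    using mult_eq_sup[OF that assms(2)] by (metis mult_self_right sup_ge2)
  ultimately show ?thesis
    using le_one_or_ge_one[of "x * y"] by (auto intro: antisym)
qed

lemma pos_mult_neg: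
  fixes x y :: 'a
  assumes "x \<le> 1" "1 \<le> y"
  shows "y * x = (if y * x \<le> 1 then x else y)"
proof -
  have "x \<le> y * x" "y * x \<le> y"
    using mult_left_mono_rl[of x 1 y] mult_right_mono_rl[of 1 y x] assms by simp_all
  moreover have "y * x \<le> x" if "y * x \<le> 1"
    using mult_eq_inf[OF that assms(1)] by (metis mult_self_right inf_le2)
  moreover have "y \<le> y * x" if "1 \<le> y * x"
    using mult_eq_sup[OF assms(2) that] by (metis mult_self_left sup_ge1)
  ultimately show ?thesis
    using le_one_or_ge_one[of "y * x"] by (auto intro: antisym)
qed

section \<open>Inverses and their comparability\<close>

lemma rinv_le_one: "1 \<le> (x::'a) \<Longrightarrow> rinv x \<le> 1"
  using mult_right_mono_rl[of 1 x "rinv x"] mult_rinv_le[of x] by simp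

lemma linv_le_one: "1 \<le> (x::'a) \<Longrightarrow> linv x \<le> 1"
  using mult_left_mono_rl[of 1 x "linv x"] linv_mult_le[of x] by simp

lemma one_le_rinv: "(x::'a) \<le> 1 \<Longrightarrow> 1 \<le> rinv x"
  by (simp add: le_rinv_iff)

lemma one_le_linv: "(x::'a) \<le> 1 \<Longrightarrow> 1 \<le> linv x"
  by (simp add: le_linv_iff)

text \<open>The assumption says that \<open>x * z\<close> is not below \<open>1\<close>, while
  \<open>x * rinv x\<close> is. If \<open>z\<close> and \<open>rinv x\<close> have equal sign,
  absorption evaluates \<open>x\<close> times their product, which is their join or meet.\<close>

lemma rinv_le_if_not_le:
  fixes x z :: 'a
  assumes "\<not> z \<le> rinv x"
  shows "rinv x \<le> z"
proof (cases "x \<le> 1")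
  case True
  then have a: "1 \<le> rinv x"
    by (rule one_le_rinv)
  with assms le_one_or_ge_one[of z] have z: "1 \<le> z"
    using order_trans by blast
  have xz: "x * z = z"
    using neg_mult_pos[OF True z] assms by (simp add: le_rinv_iff)
  have "x * rinv x = x"
    using neg_mult_pos[OF True a] mult_rinv_le[of x] by simp
  then have "x * (rinv x * z) = z"
    by (simp add: xz flip: mult.assoc)
  then have "x * sup (rinv x) z = z"
    using mult_eq_sup[OF a z] by simp
  \<comment> \<open>The value \<open>z\<close> is not \<open>x\<close>, since
    \<open>x \<le> 1 \<le> rinv x\<close>; so \<open>z\<close> is the join.\<close>
  moreover have "x * sup (rinv x) z = x \<or> x * sup (rinv x) z = sup (rinv x) z"
    using neg_mult_pos[OF True, of "sup (rinv x) z"] z by (metis le_supI2)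
  ultimately show ?thesis
    using True a assms by (metis order_trans sup_ge1)
next
  case False
  then have x: "1 \<le> x"
    using le_one_or_ge_one by blast
  then have a: "rinv x \<le> 1"
    by (rule rinv_le_one)
  show ?thesis
  proof (cases "z \<le> 1")
    case True
    have xz: "x * z = x"
      using pos_mult_neg[OF True x] assms by (simp add: le_rinv_iff)
    have "x * rinv x = rinv x"
      using pos_mult_neg[OF a x] mult_rinv_le[of x] by simp
    then have "x * (z * rinv x) = rinv x"
      by (simp add: xz flip: mult.assoc)
    then have "x * inf z (rinv x) = rinv x"
      using mult_eq_inf[OF True a] by simp
    \<comment> \<open>The value \<open>rinv x\<close> is below \<open>1\<close> and \<open>x\<close>
      is not; so \<open>rinv x\<close> is the meet.\<close>
    moreover have "x * inf z (rinv x) = x \<or> x * inf z (rinv x) = inf z (rinv x)"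
      using pos_mult_neg[OF _ x, of "inf z (rinv x)"] a by (metis le_infI2)
    ultimately show ?thesis
      using a False by (metis inf_le1)
  qed (use a le_one_or_ge_one order_trans in blast)
qed

text \<open>Left-right mirror image of the argument for \<open>rinv\<close>.\<close>

lemma linv_le_if_not_le:
  fixes x z :: 'a
  assumes "\<not> z \<le> linv x"
  shows "linv x \<le> z"
proof (cases "x \<le> 1")
  case True
  then have a: "1 \<le> linv x"
    by (rule one_le_linv)
  with assms le_one_or_ge_one[of z] have z: "1 \<le> z"
    using order_trans by blast
  have zx: "z * x = z"
    using pos_mult_neg[OF True z] assms by (simp add: le_linv_iff)
  have "linv x * x = x"
    using pos_mult_neg[OF True a] linv_mult_le[of x] by simp
  then have "(z * linv x) * x = z"
    by (simp add: zx mult.assoc)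
  then have "sup z (linv x) * x = z"
    using mult_eq_sup[OF z a] by simp
  moreover have "sup z (linv x) * x = x \<or> sup z (linv x) * x = sup z (linv x)"
    using pos_mult_neg[OF True, of "sup z (linv x)"] z by (metis le_supI1)
  ultimately show ?thesis
    using True a assms by (metis order_trans sup_ge2)
next
  case False
  then have x: "1 \<le> x"
    using le_one_or_ge_one by blast
  then have a: "linv x \<le> 1"
    by (rule linv_le_one)
  show ?thesis
  proof (cases "z \<le> 1")
    case True
    have zx: "z * x = x"
      using neg_mult_pos[OF True x] assms by (simp add: le_linv_iff)
    have "linv x * x = linv x"
      using neg_mult_pos[OF a x] linv_mult_le[of x] by simp
    then have "(linv x * z) * x = linv x"
      by (simp add: zx mult.assoc)
    then have "inf (linv x) z * x = linv x"
      using mult_eq_inf[OF a True] by simp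
    moreover have "inf (linv x) z * x = x \<or> inf (linv x) z * x = inf (linv x) z"
      using neg_mult_pos[OF _ x, of "inf (linv x) z"] a by (metis le_infI1)
    ultimately show ?thesis
      using a False by (metis inf_le2)
  qed (use a le_one_or_ge_one order_trans in blast)
qed

lemma inverse_element_comparable:
  fixes a z :: 'a
  assumes "a \<in> inverse_elements"
  shows "a \<le> z \<or> z \<le> a"
  using assms rinv_le_if_not_le linv_le_if_not_le by (auto simp: inverse_elements_def)

section \<open>The closure operator and reduction to single blocks\<close>

text \<open>By comparability, the meet of the two double inverses is one of them.\<close>

lemma gam_in_inverse_elements: "gam (x::'a) \<in> inverse_elements"
proof -
  have "rinv (linv x) \<in> inverse_elements" "linv (rinv x) \<in> inverse_elements"
    by (auto simp: inverse_elements_def)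
  then show ?thesis
    unfolding gam_def using inverse_element_comparable by (metis inf.absorb1 inf.absorb2)
qed

lemma gam_gam: "gam (gam (x::'a)) = gam x"
  by (intro gam_inverse_element gam_in_inverse_elements)

lemma le_gam_iff: "(x::'a) \<le> gam y \<longleftrightarrow> gam x \<le> gam y"
  by (metis gam_gam gam_mono le_gam order_trans)

lemma gam_le_if_not_le:
  fixes x y :: 'a
  assumes "\<not> gam y \<le> gam x"
  shows "gam x \<le> y"
  using assms inverse_element_comparable[OF gam_in_inverse_elements, of x y]
  unfolding le_gam_iff[of y] by blast

lemma gam_inf_if_not_le:
  fixes x y :: 'a
  assumes "\<not> gam y \<le> gam x"
  shows "gam (inf x y) = inf (gam x) (gam y)"
proof -
  have "gam x \<le> y"
    using assms by (rule gam_le_if_not_le)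
  \<comment> \<open>As \<open>gam x\<close> lies between \<open>x\<close> and \<open>y\<close>, both
    meets reduce to their first argument.\<close>
  then have "x \<le> y" "gam x \<le> gam y"
    using le_gam[of x] le_gam[of y] by order+
  then show ?thesis
    by (simp add: inf.absorb1)
qed

lemma conjunctive_iff_same_block:
  "conjunctive_rl TYPE('a) \<longleftrightarrow> (\<forall>x y::'a. gam x = gam y \<longrightarrow> gam (inf x y) = gam x)"
proof
  assume same: "\<forall>x y::'a. gam x = gam y \<longrightarrow> gam (inf x y) = gam x"
  have "gam (inf x y) = inf (gam x) (gam y)" for x y :: 'a
  proof -
    consider "\<not> gam y \<le> gam x" | "\<not> gam x \<le> gam y" | "gam x = gam y"
      using antisym[of "gam x" "gam y"] by blast
    then show ?thesis
    proof cases
      case 1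
      then show ?thesis
        by (rule gam_inf_if_not_le)
    next
      case 2
      then show ?thesis
        using gam_inf_if_not_le[of x y] by (simp add: inf.commute)
    next
      case 3
      moreover from this have "gam (inf x y) = gam x"
        using same by blast
      ultimately show ?thesis
        by simp
    qed
  qed
  then show "conjunctive_rl TYPE('a)"
    by (simp add: conjunctive_rl_def)
qed (simp add: conjunctive_rl_def)

section \<open>Blocks below \<open>1\<close>\<close>

lemma not_inverse_element_mult:
  fixes x y :: 'a
  assumes "x \<le> 1" "y \<le> 1" "x * y \<noteq> x" "x * y \<noteq> y"
  shows "x * y \<notin> inverse_elements"
proof
  define b where "b = x * y"
  have b: "b \<le> x" "b \<le> y" "b \<le> 1"
    using assms(1,2) by (simp_all add: b_def mult_eq_inf le_infI1)
  then have nle: "\<not> x \<le> b" "\<not> y \<le> b"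
    using assms(3,4) by (auto simp: b_def)
  have b1: "b \<noteq> 1"
    using nle(1) assms(1) by auto
  assume "x * y \<in> inverse_elements"
  then consider c where "b = linv c" | c where "b = rinv c"
    by (auto simp: inverse_elements_def b_def)
  then show False
  proof cases
    case 1
    \<comment> \<open>Otherwise \<open>c \<le> 1\<close>, whence \<open>1 \<le> linv c = b\<close>
      and \<open>b = 1\<close>.\<close>
    have c: "1 \<le> c"
      using one_le_linv[of c] le_one_or_ge_one[of c] b(3) b1 1 by auto
    \<comment> \<open>Neither \<open>x\<close> nor \<open>y\<close> is below \<open>linv c\<close>,
      so neither product is below \<open>1\<close>.\<close>
    have "x * c = c" "y * c = c"
      using neg_mult_pos[OF assms(1) c] neg_mult_pos[OF assms(2) c] nle
      by (simp_all add: 1 le_linv_iff)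
    then have "b * c = c"
      by (simp add: b_def mult.assoc)
    then have "c = 1"
      using linv_mult_le[of c] c 1 by simp
    then show False
      using b1 1 le_linv_iff[of 1 "1::'a"] b(3) by simp
  next
    case 2
    have c: "1 \<le> c"
      using one_le_rinv[of c] le_one_or_ge_one[of c] b(3) b1 2 by auto
    have "c * x = c" "c * y = c"
      using pos_mult_neg[OF assms(1) c] pos_mult_neg[OF assms(2) c] nle
      by (simp_all add: 2 le_rinv_iff)
    then have "c * b = c"
      by (simp add: b_def flip: mult.assoc)
    then have "c = 1"
      using mult_rinv_le[of c] c 2 by simp
    then show False
      using b1 2 le_rinv_iff[of 1 "1::'a"] b(3) by simp
  qed
qed

lemma gam_inf_negative_block:
  fixes x y :: 'a
  assumes eq: "gam x = gam y" and neg: "gam x \<le> 1"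
  shows "gam (inf x y) = gam x"
proof (rule ccontr)
  assume ne: "gam (inf x y) \<noteq> gam x"
  have x: "x \<le> 1" and y: "y \<le> 1"
    using eq neg le_gam order_trans by metis+
  \<comment> \<open>The closure of the meet is strictly below \<open>gam x = gam y\<close>, so
    comparability puts it below \<open>x\<close> and \<open>y\<close>; hence the meet is
    closed.\<close>
  have "\<not> gam x \<le> gam (inf x y)"
    using ne gam_mono[of "inf x y" x] by auto
  then have "gam (inf x y) \<le> inf x y"
    using gam_le_if_not_le[of x "inf x y"] gam_le_if_not_le[of y "inf x y"] eq by (metis le_infI)
  then have "gam (inf x y) = x * y"
    using le_gam[of "inf x y"] mult_eq_inf[OF x y] by (metis antisym)
  then have "x * y \<in> inverse_elements"
    by (metis gam_in_inverse_elements)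
  moreover have "x * y \<noteq> x" "x * y \<noteq> y"
    using ne eq mult_eq_inf[OF x y] by auto
  ultimately show False
    using not_inverse_element_mult[OF x y] by blast
qed

section \<open>Lattice blocks and conjunctivity\<close>

lemma is_lattice_on_block_iff:
  fixes a :: 'a
  assumes a: "a \<in> inverse_elements"
  shows "is_lattice_on (gam -` {a}) \<longleftrightarrow>
    (\<forall>x y. gam x = a \<and> gam y = a \<longrightarrow> gam (inf x y) = a)"
    (is "is_lattice_on ?B \<longleftrightarrow> ?R")
proof
  let ?L = "\<lparr>carrier = ?B, eq = (=), le = (\<le>)\<rparr>"
  assume "is_lattice_on ?B"
  then interpret Lattice.lattice ?L
    by (simp add: is_lattice_on_def)
  show ?R
  proof (intro allI impI)
    fix x y :: 'a
    assume xy: "gam x = a \<and> gam y = a"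
    then obtain z where "greatest ?L z (Lower ?L {x, y})"
      using inf_of_two_exists[of x y] by auto
    \<comment> \<open>The meet \<open>z\<close> within the block may a priori differ from
      \<open>inf x y\<close>, but as a common lower bound it squeezes \<open>gam (inf x y)\<close>
      between \<open>gam z\<close> and \<open>gam x\<close>.\<close>
    then have z: "gam z = a" "z \<le> x" "z \<le> y"
      using xy by (auto simp: greatest_def Lower_def)
    have "a \<le> gam (inf x y)"
      using z gam_mono[of z "inf x y"] by simp
    moreover have "gam (inf x y) \<le> a"
      using xy gam_mono[of "inf x y" x] by simp
    ultimately show "gam (inf x y) = a"
      by simp
  qed
next
  let ?L = "\<lparr>carrier = ?B, eq = (=), le = (\<le>)\<rparr>"
  assume R: ?R
  interpret partial_order ?L
    by unfold_locales auto
  \<comment> \<open>Joins stay in the block because \<open>a\<close> is closed and bounds it from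
    above.\<close>
  have sup: "gam (sup x y) = a" if "gam x = a" "gam y = a" for x y
  proof (rule antisym)
    have "sup x y \<le> gam a"
      using that le_gam[of x] le_gam[of y] gam_inverse_element[OF a] by simp
    then show "gam (sup x y) \<le> a"
      using le_gam_iff gam_inverse_element[OF a] by metis
    show "a \<le> gam (sup x y)"
      using that gam_mono[of x "sup x y"] by simp
  qed
  have "Lattice.lattice ?L"
  proof unfold_locales
    fix x y
    assume "x \<in> carrier ?L" "y \<in> carrier ?L"
    then have "least ?L (sup x y) (Upper ?L {x, y})"
      using sup by (auto simp: least_def Upper_def)
    then show "\<exists>s. least ?L s (Upper ?L {x, y})" ..
  next
    fix x y
    assume "x \<in> carrier ?L" "y \<in> carrier ?L"
    then have "greatest ?L (inf x y) (Lower ?L {x, y})"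
      using R by (auto simp: greatest_def Lower_def)
    then show "\<exists>s. greatest ?L s (Lower ?L {x, y})" ..
  qed
  then show "is_lattice_on ?B"
    by (simp add: is_lattice_on_def)
qed

lemma conjunctive_iff_blocks:
  "conjunctive_rl TYPE('a) \<longleftrightarrow> (\<forall>B \<in> (blocks :: 'a set set). is_lattice_on B)"
proof -
  have "(\<forall>B \<in> (blocks :: 'a set set). is_lattice_on B) \<longleftrightarrow>
    (\<forall>a \<in> inverse_elements. is_lattice_on (gam -` {a :: 'a}))"
    unfolding blocks_def by blast
  also have "\<dots> \<longleftrightarrow>
    (\<forall>a \<in> inverse_elements. \<forall>x y::'a. gam x = a \<and> gam y = a \<longrightarrow> gam (inf x y) = a)"
    by (intro ball_cong refl is_lattice_on_block_iff)
  also have "\<dots> \<longleftrightarrow> conjunctive_rl TYPE('a)"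
    unfolding conjunctive_iff_same_block
    by (auto simp: gam_in_inverse_elements)
  finally show ?thesis
    by simp
qed

lemma conjunctive_iff_positive_blocks:
  "conjunctive_rl TYPE('a) \<longleftrightarrow> (\<forall>B \<in> (positive_blocks :: 'a set set). is_lattice_on B)"
proof
  assume "conjunctive_rl TYPE('a)"
  moreover have "positive_blocks \<subseteq> (blocks :: 'a set set)"
    unfolding positive_blocks_def blocks_def by blast
  ultimately show "\<forall>B \<in> (positive_blocks :: 'a set set). is_lattice_on B"
    unfolding conjunctive_iff_blocks by blast
next
  assume pos: "\<forall>B \<in> (positive_blocks :: 'a set set). is_lattice_on B"
  have "gam (inf x y) = gam x" if eq: "gam x = gam y" for x y :: 'a
  \<comment> \<open>Blocks below \<open>1\<close> satisfy the meet condition outright; by conicity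
    every other block is positive, so \<open>pos\<close> applies.\<close>
  proof (cases "gam x \<le> 1")
    case True
    with eq show ?thesis
      by (rule gam_inf_negative_block)
  next
    case False
    then have "1 \<le> gam x"
      using le_one_or_ge_one by blast
    then have "gam -` {gam x} \<in> positive_blocks"
      using gam_in_inverse_elements unfolding positive_blocks_def by blast
    then have "is_lattice_on (gam -` {gam x})"
      using pos by blast
    then show ?thesis
      using eq unfolding is_lattice_on_block_iff[OF gam_in_inverse_elements] by simp
  qed
  then show "conjunctive_rl TYPE('a)"
    unfolding conjunctive_iff_same_block by blast
qed

end

theorem lemma5p4:
  assumes "conic_rl TYPE('a::residuated_lattice)"
    and "idempotent_rl TYPE('a)"
  shows "(conjunctive_rl TYPE('a) \<longleftrightarrow> (\<forall>B \<in> (blocks :: 'a set set). is_lattice_on B)) \<and>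
         (conjunctive_rl TYPE('a) \<longleftrightarrow> (\<forall>B \<in> (positive_blocks :: 'a set set). is_lattice_on B))"
  using conjunctive_iff_blocks[OF assms] conjunctive_iff_positive_blocks[OF assms] by (rule conjI)

end
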